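(* Let $M\in\mathbb N$ and $\mathcal A\subset\{0,\dots,M-1\}$ with $1<|\mathcal A|<M$, and let $\delta=\log|\mathcal A|/\log M$. Define $$G_{\mathcal A}(x)=\frac1{\sqrt M}\sum_{a\in\mathcal A}\exp(-2\pi iax),\quad x\in\mathbb R.$$ Assume that there exist $b,b'\in\mathcal A$, $b\ne b'$, such that $$G_{\mathcal A}\Big(\frac{b'-b}M\Big)\,G_{\mathcal A}\Big(\frac{b'-b}{M^2}\Big)\ne0.$$ Then the fractal uncertainty exponent $\beta=\beta(M,\mathcal A)$ satisfies $\beta<(1-\delta)/2$.
   Context: $\mathbb Z_N=\mathbb Z/N\mathbb Z\simeq\{0,\dots,N-1\}$; $\ell^2_N$ is the space of functions $u:\mathbb Z_N\to\mathbb C$ with $\|u\|_{\ell^2_N}^2=\sum_j|u(j)|^2$; $\mathcal F_Nu(j)=\frac1{\sqrt N}\sum_{\ell=0}^{N-1}\exp(-2\pi ij\ell/N)u(\ell)$; $\mathbf 1_X$ is multiplication by the indicator function of $X\subset\mathbb Z_N$. For $N=M^k$: $\mathcal C_k=\{\sum_{j=0}^{k-1}a_jM^j\mid a_0,\dots,a_{k-1}\in\mathcal A\}\subset\mathbb Z_N$ and $r_k=\|\mathbf 1_{\mathcal C_k}\mathcal F_N\mathbf 1_{\mathcal C_k}\|_{\ell^2_N\to\ell^2_N}$. The fractal uncertainty exponent is $\beta(M,\mathcal A)=-\lim_{k\to\infty}\frac{\log r_k}{k\log M}$ (the limit exists). *)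

theory Defs
  imports "HOL-Analysis.Analysis"
begin

text \<open>
  The residue ring of integers modulo \<open>N\<close> is represented by \<open>{..<N}\<close>, and a complex function
  on it by a function on \<open>nat\<close> that vanishes outside \<open>{..<N}\<close>.
\<close>

definition ell2 :: "nat \<Rightarrow> (nat \<Rightarrow> complex) set" where
  "ell2 N = {u. \<forall>j\<ge>N. u j = 0}"

definition ell2_norm :: "nat \<Rightarrow> (nat \<Rightarrow> complex) \<Rightarrow> real" where
  "ell2_norm N u = L2_set (\<lambda>j. cmod (u j)) {..<N}"

definition ell2_opnorm :: "nat \<Rightarrow> ((nat \<Rightarrow> complex) \<Rightarrow> (nat \<Rightarrow> complex)) \<Rightarrow> real" where
  "ell2_opnorm N T = (SUP u\<in>{u \<in> ell2 N. ell2_norm N u \<le> 1}. ell2_norm N (T u))"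

definition dft :: "nat \<Rightarrow> (nat \<Rightarrow> complex) \<Rightarrow> (nat \<Rightarrow> complex)" where
  "dft N u = (\<lambda>j. if j < N
     then 1 / complex_of_real (sqrt (real N)) *
       (\<Sum>l<N. exp (- 2 * complex_of_real pi * \<i> * of_nat j * of_nat l / of_nat N) * u l)
     else 0)"

definition indicator_mult :: "nat set \<Rightarrow> (nat \<Rightarrow> complex) \<Rightarrow> (nat \<Rightarrow> complex)" where
  "indicator_mult X u = (\<lambda>j. indicator X j * u j)"

text \<open>
  For \<open>A \<subseteq> {..<M}\<close> the sums below are smaller than \<open>M ^ k\<close>, so no reduction modulo \<open>M ^ k\<close>
  is needed.
\<close>

definition cantor_set :: "nat \<Rightarrow> nat set \<Rightarrow> nat \<Rightarrow> nat set" where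
  "cantor_set M A k = {(\<Sum>j<k. a j * M ^ j) |a. \<forall>j<k. a j \<in> A}"

definition fup_norm :: "nat \<Rightarrow> nat set \<Rightarrow> nat \<Rightarrow> real" where
  "fup_norm M A k = ell2_opnorm (M ^ k)
     (indicator_mult (cantor_set M A k) \<circ> dft (M ^ k) \<circ> indicator_mult (cantor_set M A k))"

definition fup_exponent :: "nat \<Rightarrow> nat set \<Rightarrow> real" where
  "fup_exponent M A = - lim (\<lambda>k. ln (fup_norm M A k) / (real k * ln (real M)))"

definition G :: "nat \<Rightarrow> nat set \<Rightarrow> real \<Rightarrow> complex" where
  "G M A x = 1 / complex_of_real (sqrt (real M)) *
     (\<Sum>a\<in>A. exp (- 2 * complex_of_real pi * \<i> * of_nat a * complex_of_real x))"

end

theory Submission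
  imports Defs
begin

text \<open>
  Write \<open>C\<^sub>k\<close> for the Cantor set of order \<open>k\<close>, \<open>N = M ^ k\<close>, and \<open>r\<^sub>k\<close> for the norm of the compressed
  Fourier transform. A factorization as in the fast Fourier transform shows that \<open>r\<^sub>k\<close> is
  submultiplicative (\<open>fup_norm_submultiplicative\<close>), so by Fekete's lemma the limit in the exponent
  exists, and it remains to bound \<open>r\<^sub>k\<close> from below along the multiples \<open>k = L m\<close> of some \<open>L\<close>.

  For the lower bound, the operator is applied to the indicator function of \<open>C\<^sub>k\<close> modulated by a
  frequency \<open>z \<in> C\<^sub>k\<close>. This gives that \<open>r\<^sub>k\<^sup>2\<close> times the cardinality of \<open>C\<^sub>k\<close> is at least the sum over
  \<open>j \<in> C\<^sub>k\<close> of the squares of the Fourier coefficients of the indicator function at \<open>j - z\<close>. By the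
  digit structure, the absolute value of such a coefficient is the product of \<open>|G ((j - z) / M ^ s)|\<close>
  over \<open>1 \<le> s \<le> k\<close>. The term \<open>j = z\<close> alone yields \<open>r\<^sub>k\<^sup>2 \<ge> (|A| / M) ^ k\<close>, that is, the exponent
  \<open>(1 - \<delta>) / 2\<close>, and any exponential gain from the other terms makes the inequality strict.

  To obtain the gain, let all the digits of \<open>z\<close> be \<open>b\<close>, and let \<open>j\<close> arise from \<open>z\<close> by changing an
  arbitrary set of digits, at positions that are multiples of \<open>L\<close>, to \<open>b'\<close>. Relative to the term
  \<open>j = z\<close>, a changed digit costs a factor that is governed by the values of \<open>G\<close> near \<open>(b' - b) / M\<close>,
  \<open>(b' - b) / M\<^sup>2\<close> and at still smaller arguments. The first two are nonzero by hypothesis, and those from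
  the third on have a positive product since the phases in \<open>G\<close> almost agree. So the cost of a change is
  bounded below by some \<open>w > 0\<close> independent of \<open>L\<close>, whereas a block of \<open>L\<close> digits without a change
  costs at most a factor \<open>1 - \<epsilon>\<close> through the changes below it, with \<open>\<epsilon>\<close> tending to zero as \<open>L\<close> grows.
  Summing over all the choices gives at least \<open>(1 - \<epsilon> + w) ^ m\<close>, which grows exponentially once
  \<open>\<epsilon> < w\<close> (\<open>sum_weight_growth\<close>).
\<close>

section \<open>Subadditive sequences\<close>

lemma subadditive_mult_add_le:
  fixes u :: "nat \<Rightarrow> real"
  assumes "\<And>m n. u (m + n) \<le> u m + u n"
  shows "u (n * q + r) \<le> real q * u n + u r"
proof (induction q)
  case (Suc q)
  have "u (n * Suc q + r) \<le> u n + u (n * q + r)"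
    using assms[of n "n * q + r"] by (simp add: algebra_simps)
  with Suc show ?case by (simp add: algebra_simps)
qed auto

text \<open>
  Fekete's lemma. Every average exceeds the infimum \<open>a\<close> of all averages; conversely, if the average
  at \<open>n\<close> is close to \<open>a\<close>, division with remainder by \<open>n\<close> bounds the average at every \<open>k\<close> by the one
  at \<open>n\<close> up to an error \<open>K / k\<close>.
\<close>

lemma subadditive_average_convergent:
  fixes u :: "nat \<Rightarrow> real"
  assumes sub: "\<And>m n. u (m + n) \<le> u m + u n"
    and lower: "\<And>n. c * real n \<le> u n"
  shows "convergent (\<lambda>n. u n / real n)"
proof -
  define a where "a = (INF n\<in>{1..}. u n / real n)"
  have bdd: "bdd_below ((\<lambda>n. u n / real n) ` {1..})"
    using lower by (intro bdd_belowI[of _ c]) (auto simp: field_simps)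
  have "(\<lambda>n. u n / real n) \<longlonglongrightarrow> a"
  proof (rule order_tendstoI)
    fix x assume "x < a"
    have "x < u n / real n" if "1 \<le> n" for n
      using cINF_lower[OF bdd, of n] that \<open>x < a\<close> by (simp add: a_def)
    then show "\<forall>\<^sub>F n in sequentially. x < u n / real n"
      by (rule eventually_sequentiallyI)
  next
    fix x assume "a < x"
    then obtain n where n: "1 \<le> n" "u n / real n < x"
      unfolding a_def using cINF_less_iff[OF _ bdd, of x] by auto
    define K where "K = (MAX r\<in>{..<n}. \<bar>u r\<bar>) + \<bar>u n\<bar>"
    have bound: "u k / real k \<le> u n / real n + K / real k" if "1 \<le> k" for k
    proof -
      define q r where "q = k div n" and "r = k mod n"
      have r: "r < n" and k: "k = n * q + r"
        using n by (simp_all add: q_def r_def)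
      have "\<bar>u r\<bar> \<le> (MAX r\<in>{..<n}. \<bar>u r\<bar>)"
        using r by (intro Max_ge) auto
      moreover have "real q * u n = real k * (u n / real n) - real r / real n * u n"
        using n by (simp add: k field_simps)
      moreover have "\<bar>real r / real n * u n\<bar> \<le> 1 * \<bar>u n\<bar>"
        unfolding abs_mult using r n by (intro mult_right_mono) auto
      ultimately have "u k \<le> real k * (u n / real n) + K"
        using subadditive_mult_add_le[OF sub, of n q r] unfolding K_def k by linarith
      then show ?thesis using that by (simp add: field_simps)
    qed
    have "(\<lambda>k. u n / real n + K / real k) \<longlonglongrightarrow> u n / real n + 0"
      by (intro tendsto_add tendsto_const tendsto_divide_0[OF tendsto_const]
          filterlim_at_top_imp_at_infinity filterlim_real_sequentially)
    then have "\<forall>\<^sub>F k in sequentially. u n / real n + K / real k < x"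
      using n by (intro order_tendstoD(2)) auto
    moreover have "\<forall>\<^sub>F k in sequentially. u k / real k \<le> u n / real n + K / real k"
      using bound by (rule eventually_sequentiallyI)
    ultimately show "\<forall>\<^sub>F k in sequentially. u k / real k < x"
      by eventually_elim linarith
  qed
  then show ?thesis by (auto simp: convergent_def)
qed

section \<open>Phases\<close>

definition phase :: "real \<Rightarrow> complex" where
  "phase x = cis (- (2 * pi * x))"

lemma phase_add: "phase (x + y) = phase x * phase y"
  by (simp add: phase_def cis_mult algebra_simps)

lemma phase_of_int: "phase (of_int n) = 1"
  by (simp add: phase_def cis.ctr complex_eq_iff)

lemma phase_of_nat [simp]: "phase (real n) = 1"
  using phase_of_int[of "int n"] by simp

lemma cmod_phase [simp]: "cmod (phase x) = 1"
  by (simp add: phase_def)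

lemma exp_eq_phase:
  "exp (- 2 * complex_of_real pi * \<i> * of_nat j * complex_of_real x) = phase (real j * x)"
  "exp (- 2 * complex_of_real pi * \<i> * of_nat j * of_nat l / of_nat N)
      = phase (real j * real l / real N)"
  by (simp_all add: phase_def cis_conv_exp mult_ac)

section \<open>The operator norm as an inequality for exponential sums\<close>

lemma cantor_set_subset:
  assumes "A \<subseteq> {0..<M}"
  shows "cantor_set M A k \<subseteq> {..<M ^ k}"
proof
  fix c assume "c \<in> cantor_set M A k"
  then obtain a where a: "\<forall>j<k. a j \<in> A" and c: "c = (\<Sum>j<k. a j * M ^ j)"
    by (auto simp: cantor_set_def)
  have "(\<Sum>j<k. a j * M ^ j) < M ^ k" using a
  proof (induction k)
    case (Suc k)
    have "Suc (a k) * M ^ k \<le> M * M ^ k"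
      using Suc.prems assms by (intro mult_right_mono) (auto simp: Suc_le_eq)
    with Suc show ?case by auto
  qed auto
  with c show "c \<in> {..<M ^ k}" by simp
qed

text \<open>
  The compressed Fourier transform without its factor \<open>1 / sqrt N\<close>. Working with this sum turns
  statements about \<^term>\<open>fup_norm\<close> into inequalities between finite sums over the Cantor set, in which
  the values of \<open>v\<close> elsewhere are irrelevant; \<open>sum_cantor_dft_sum_le\<close> and \<open>fup_norm_le\<close> together say that
  \<^term>\<open>fup_norm\<close> is the best constant in that inequality.
\<close>

definition cantor_dft_sum :: "nat \<Rightarrow> nat set \<Rightarrow> nat \<Rightarrow> (nat \<Rightarrow> complex) \<Rightarrow> nat \<Rightarrow> complex" where
  "cantor_dft_sum M A k v j =
     (\<Sum>l\<in>cantor_set M A k. phase (real j * real l / real (M ^ k)) * v l)"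

lemma ell2_norm_compressed_dft:
  fixes M k :: nat
  assumes "A \<subseteq> {0..<M}" and "0 < M"
  defines "C \<equiv> cantor_set M A k"
  shows "(ell2_norm (M ^ k) ((indicator_mult C \<circ> dft (M ^ k) \<circ> indicator_mult C) v))\<^sup>2
    = (\<Sum>j\<in>C. (cmod (cantor_dft_sum M A k v j))\<^sup>2) / real (M ^ k)"
proof -
  have C: "C \<subseteq> {..<M ^ k}" unfolding C_def by (rule cantor_set_subset[OF assms(1)])
  have "dft (M ^ k) (indicator_mult C v) j
      = complex_of_real (1 / sqrt (real (M ^ k))) * cantor_dft_sum M A k v j" if "j \<in> C" for j
  proof -
    have "(\<Sum>l<M ^ k. phase (real j * real l / real (M ^ k)) * (indicator C l * v l))
        = cantor_dft_sum M A k v j"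
      unfolding cantor_dft_sum_def C_def[symmetric] using C
      by (intro sum.mono_neutral_cong_right) auto
    moreover have "j < M ^ k" using that C by auto
    ultimately show ?thesis
      unfolding dft_def indicator_mult_def exp_eq_phase by (simp only: if_True of_real_divide of_real_1)
  qed
  then have eq: "(cmod (dft (M ^ k) (indicator_mult C v) j))\<^sup>2
      = (cmod (cantor_dft_sum M A k v j))\<^sup>2 / real (M ^ k)" if "j \<in> C" for j
    using that by (simp add: norm_mult norm_divide power_mult_distrib power_divide del: of_nat_power)
  have "(ell2_norm (M ^ k) ((indicator_mult C \<circ> dft (M ^ k) \<circ> indicator_mult C) v))\<^sup>2
    = (\<Sum>j<M ^ k. (cmod (indicator C j * dft (M ^ k) (indicator_mult C v) j))\<^sup>2)"
    by (simp add: ell2_norm_def L2_set_def indicator_mult_def sum_nonneg)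
  also have "\<dots> = (\<Sum>j\<in>C. (cmod (cantor_dft_sum M A k v j))\<^sup>2 / real (M ^ k))"
    using C eq by (intro sum.mono_neutral_cong_right) auto
  finally show ?thesis by (simp only: sum_divide_distrib)
qed

lemma ell2_norm_sq: "(ell2_norm N u)\<^sup>2 = (\<Sum>j<N. (cmod (u j))\<^sup>2)"
  by (simp add: ell2_norm_def L2_set_def sum_nonneg)

text \<open>
  The supremum in the operator norm bounds the individual norms only if the set is bounded; the crude
  estimate of each Fourier sum by the number of its terms suffices for this.
\<close>

lemma bdd_above_compressed_dft:
  fixes M k :: nat
  assumes "A \<subseteq> {0..<M}" and "0 < M"
  defines "C \<equiv> cantor_set M A k"
  shows "bdd_above ((\<lambda>u. ell2_norm (M ^ k) ((indicator_mult C \<circ> dft (M ^ k) \<circ> indicator_mult C) u))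
    ` {u \<in> ell2 (M ^ k). ell2_norm (M ^ k) u \<le> 1})"
proof (rule bdd_aboveI2)
  fix u assume "u \<in> {u \<in> ell2 (M ^ k). ell2_norm (M ^ k) u \<le> 1}"
  then have u: "ell2_norm (M ^ k) u \<le> 1" by simp
  have C: "C \<subseteq> {..<M ^ k}" unfolding C_def by (rule cantor_set_subset[OF assms(1)])
  have "cmod (u l) \<le> 1" if "l \<in> C" for l
    using u member_le_L2_set[of "{..<M ^ k}" l "\<lambda>j. cmod (u j)"] that C
    unfolding ell2_norm_def by force
  then have "cmod (cantor_dft_sum M A k u j) \<le> (\<Sum>l\<in>C. 1)" for j
    unfolding cantor_dft_sum_def C_def[symmetric]
    by (intro sum_norm_le) (auto simp: norm_mult)
  then have "(\<Sum>j\<in>C. (cmod (cantor_dft_sum M A k u j))\<^sup>2) \<le> (\<Sum>j\<in>C. (real (card C))\<^sup>2)"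
    by (intro sum_mono power_mono) auto
  then have "(ell2_norm (M ^ k) ((indicator_mult C \<circ> dft (M ^ k) \<circ> indicator_mult C) u))\<^sup>2
    \<le> (\<Sum>j\<in>C. (real (card C))\<^sup>2) / real (M ^ k)"
    using ell2_norm_compressed_dft[OF assms(1,2), of k u] unfolding C_def
    by (simp only: divide_right_mono of_nat_0_le_iff)
  then show "ell2_norm (M ^ k) ((indicator_mult C \<circ> dft (M ^ k) \<circ> indicator_mult C) u)
    \<le> sqrt ((\<Sum>j\<in>C. (real (card C))\<^sup>2) / real (M ^ k))"
    by (rule real_le_rsqrt)
qed

lemma fup_norm_nonneg:
  assumes "A \<subseteq> {0..<M}" and "0 < M"
  shows "0 \<le> fup_norm M A k"
proof -
  let ?T = "indicator_mult (cantor_set M A k) \<circ> dft (M ^ k) \<circ> indicator_mult (cantor_set M A k)"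
  have "0 \<le> ell2_norm (M ^ k) (?T (\<lambda>_. 0))"
    by (simp add: ell2_norm_def)
  also have "\<dots> \<le> fup_norm M A k"
    unfolding fup_norm_def ell2_opnorm_def
    using assms by (intro cSUP_upper bdd_above_compressed_dft) (auto simp: ell2_def ell2_norm_def L2_set_def)
  finally show ?thesis .
qed

lemma sum_cantor_dft_sum_le:
  fixes M k :: nat
  assumes "A \<subseteq> {0..<M}" and "0 < M"
  defines "C \<equiv> cantor_set M A k"
  shows "(\<Sum>j\<in>C. (cmod (cantor_dft_sum M A k v j))\<^sup>2)
    \<le> real (M ^ k) * (fup_norm M A k)\<^sup>2 * (\<Sum>l\<in>C. (cmod (v l))\<^sup>2)"
proof (cases "(\<Sum>l\<in>C. (cmod (v l))\<^sup>2) = 0")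
  case True
  have "finite C" unfolding C_def using cantor_set_subset[OF assms(1)] finite_subset by blast
  with True have "v l = 0" if "l \<in> C" for l
    using that by (auto simp: sum_nonneg_eq_0_iff)
  then have "cantor_dft_sum M A k v j = 0" for j
    by (simp add: cantor_dft_sum_def C_def)
  then show ?thesis by (simp add: True)
next
  case False
  define s where "s = sqrt (\<Sum>l\<in>C. (cmod (v l))\<^sup>2)"
  have s: "0 < s" "s\<^sup>2 = (\<Sum>l\<in>C. (cmod (v l))\<^sup>2)"
    using False by (simp_all add: s_def less_le sum_nonneg)
  define u where "u = (\<lambda>l. indicator C l * v l / complex_of_real s)"
  have C: "C \<subseteq> {..<M ^ k}" unfolding C_def by (rule cantor_set_subset[OF assms(1)])
  have "u \<in> ell2 (M ^ k)" using C by (auto simp: ell2_def u_def indicator_def)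
  moreover have "(ell2_norm (M ^ k) u)\<^sup>2 = (\<Sum>l\<in>C. (cmod (v l))\<^sup>2 / s\<^sup>2)"
    unfolding ell2_norm_sq using C
    by (intro sum.mono_neutral_cong_right) (auto simp: u_def norm_divide norm_mult power_divide)
  then have "(ell2_norm (M ^ k) u)\<^sup>2 = 1"
    using s(1) by (simp add: sum_divide_distrib[symmetric] s(2)[symmetric])
  then have "ell2_norm (M ^ k) u \<le> 1"
    by (simp add: abs_square_eq_1)
  ultimately have "ell2_norm (M ^ k) ((indicator_mult C \<circ> dft (M ^ k) \<circ> indicator_mult C) u)
      \<le> fup_norm M A k"
    unfolding fup_norm_def ell2_opnorm_def C_def
    using assms(1,2) by (intro cSUP_upper bdd_above_compressed_dft) auto
  then have "(ell2_norm (M ^ k) ((indicator_mult C \<circ> dft (M ^ k) \<circ> indicator_mult C) u))\<^sup>2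
      \<le> (fup_norm M A k)\<^sup>2"
    by (intro power_mono) (auto simp: ell2_norm_def)
  then have "(\<Sum>j\<in>C. (cmod (cantor_dft_sum M A k u j))\<^sup>2) / real (M ^ k) \<le> (fup_norm M A k)\<^sup>2"
    using ell2_norm_compressed_dft[OF assms(1,2), of k u] unfolding C_def by simp
  moreover have "cantor_dft_sum M A k u j = cantor_dft_sum M A k v j / complex_of_real s" for j
    unfolding cantor_dft_sum_def C_def[symmetric] sum_divide_distrib
    by (intro sum.cong) (auto simp: u_def)
  ultimately have "(\<Sum>j\<in>C. (cmod (cantor_dft_sum M A k v j))\<^sup>2) / s\<^sup>2 / real (M ^ k)
      \<le> (fup_norm M A k)\<^sup>2"
    by (simp add: norm_divide power_divide sum_divide_distrib)
  then show ?thesis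
    using s(1) assms(2) unfolding s(2)[symmetric] by (simp add: field_simps)
qed

lemma fup_norm_le:
  assumes "A \<subseteq> {0..<M}" and "0 < M" and "0 \<le> B"
    and le: "\<And>v. (\<Sum>j\<in>cantor_set M A k. (cmod (cantor_dft_sum M A k v j))\<^sup>2)
      \<le> real (M ^ k) * B\<^sup>2 * (\<Sum>l\<in>cantor_set M A k. (cmod (v l))\<^sup>2)"
  shows "fup_norm M A k \<le> B"
  unfolding fup_norm_def ell2_opnorm_def
proof (rule cSUP_least)
  have "(\<lambda>_. 0) \<in> {u \<in> ell2 (M ^ k). ell2_norm (M ^ k) u \<le> 1}"
    by (auto simp: ell2_def ell2_norm_def L2_set_def)
  then show "{u \<in> ell2 (M ^ k). ell2_norm (M ^ k) u \<le> 1} \<noteq> {}" by blast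
next
  fix u assume "u \<in> {u \<in> ell2 (M ^ k). ell2_norm (M ^ k) u \<le> 1}"
  then have "(ell2_norm (M ^ k) u)\<^sup>2 \<le> 1\<^sup>2"
    by (intro power_mono) (auto simp: ell2_norm_def)
  moreover have "(\<Sum>l\<in>cantor_set M A k. (cmod (u l))\<^sup>2) \<le> (ell2_norm (M ^ k) u)\<^sup>2"
    unfolding ell2_norm_sq using cantor_set_subset[OF assms(1)] by (intro sum_mono2) auto
  ultimately have "real (M ^ k) * B\<^sup>2 * (\<Sum>l\<in>cantor_set M A k. (cmod (u l))\<^sup>2) \<le> real (M ^ k) * B\<^sup>2 * 1"
    by (intro mult_left_mono) auto
  with le[of u] have "(\<Sum>j\<in>cantor_set M A k. (cmod (cantor_dft_sum M A k u j))\<^sup>2)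
      \<le> real (M ^ k) * B\<^sup>2"
    by linarith
  then have "(\<Sum>j\<in>cantor_set M A k. (cmod (cantor_dft_sum M A k u j))\<^sup>2) / real (M ^ k) \<le> B\<^sup>2"
    using assms(2) by (simp add: field_simps)
  then show "ell2_norm (M ^ k) ((indicator_mult (cantor_set M A k) \<circ> dft (M ^ k)
      \<circ> indicator_mult (cantor_set M A k)) u) \<le> B"
    unfolding ell2_norm_compressed_dft[OF assms(1,2), symmetric]
    by (rule power2_le_imp_le[OF _ assms(3)])
qed

section \<open>Splitting the digits\<close>

lemma sum_lessThan_add:
  fixes f :: "nat \<Rightarrow> 'a::comm_monoid_add"
  shows "(\<Sum>j<k + l. f j) = (\<Sum>j<k. f j) + (\<Sum>j<l. f (k + j))"
  by (induction l) (simp_all add: add.assoc)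

lemma prod_lessThan_add:
  fixes f :: "nat \<Rightarrow> 'a::comm_monoid_mult"
  shows "(\<Prod>j<k + l. f j) = (\<Prod>j<k. f j) * (\<Prod>j<l. f (k + j))"
  by (induction l) (simp_all add: mult.assoc)

lemma cantor_set_0: "cantor_set M A 0 = {0}"
  by (auto simp: cantor_set_def)

lemma cantor_set_1: "cantor_set M A (Suc 0) = A"
  by (auto simp: cantor_set_def intro!: exI[of _ "\<lambda>_. x" for x])

text \<open>
  An expansion with \<open>k + l\<close> digits is cut into its \<open>k\<close> low and its \<open>l\<close> high digits. Cutting frequencies
  and positions in this way, but with the roles of \<open>k\<close> and \<open>l\<close> exchanged, factorizes the Fourier
  transform; cutting off a single digit factorizes the exponential sum over the Cantor set.
\<close>

lemma cantor_set_add: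
  "cantor_set M A (k + l) = (\<lambda>(c, e). c + M ^ k * e) ` (cantor_set M A k \<times> cantor_set M A l)"
proof (intro equalityI subsetI)
  fix x assume "x \<in> cantor_set M A (k + l)"
  then obtain a where a: "\<forall>j<k + l. a j \<in> A" and x: "x = (\<Sum>j<k + l. a j * M ^ j)"
    by (auto simp: cantor_set_def)
  have "x = (\<Sum>j<k. a j * M ^ j) + M ^ k * (\<Sum>j<l. a (k + j) * M ^ j)"
    by (simp add: x sum_lessThan_add sum_distrib_left power_add mult_ac)
  moreover have "(\<Sum>j<k. a j * M ^ j) \<in> cantor_set M A k"
    using a by (auto simp: cantor_set_def)
  moreover have "(\<Sum>j<l. a (k + j) * M ^ j) \<in> cantor_set M A l"
    using a by (auto simp: cantor_set_def intro!: exI[of _ "\<lambda>j. a (k + j)"])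
  ultimately show "x \<in> (\<lambda>(c, e). c + M ^ k * e) ` (cantor_set M A k \<times> cantor_set M A l)"
    by auto
next
  fix x assume "x \<in> (\<lambda>(c, e). c + M ^ k * e) ` (cantor_set M A k \<times> cantor_set M A l)"
  then obtain a a' where a: "\<forall>j<k. a j \<in> A" "\<forall>j<l. a' j \<in> A"
    and x: "x = (\<Sum>j<k. a j * M ^ j) + M ^ k * (\<Sum>j<l. a' j * M ^ j)"
    by (auto simp: cantor_set_def)
  define b where "b = (\<lambda>j. if j < k then a j else a' (j - k))"
  have "x = (\<Sum>j<k + l. b j * M ^ j)"
    by (simp add: x b_def sum_lessThan_add sum_distrib_left power_add mult_ac)
  moreover have "\<forall>j<k + l. b j \<in> A"
    using a by (auto simp: b_def)
  ultimately show "x \<in> cantor_set M A (k + l)"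
    by (auto simp: cantor_set_def)
qed

lemma add_mult_inject:
  fixes n c c' e e' :: nat
  assumes "c < n" and "c' < n" and "c + n * e = c' + n * e'"
  shows "c = c' \<and> e = e'"
proof -
  have "(c + n * e) mod n = (c' + n * e') mod n" "(c + n * e) div n = (c' + n * e') div n"
    using assms(3) by simp_all
  then show ?thesis using assms(1,2) by simp
qed

locale cantor_alphabet =
  fixes M :: nat and A :: "nat set"
  assumes alphabet: "A \<subseteq> {0..<M}" and card_gt_1: "1 < card A" and card_less: "card A < M"
begin

abbreviation "C \<equiv> cantor_set M A"

lemma M_ge_3: "3 \<le> M"
  using card_gt_1 card_less by linarith

lemma M_pos: "0 < M"
  using M_ge_3 by simp

lemma cantor_less: "c \<in> C k \<Longrightarrow> c < M ^ k"
  using cantor_set_subset[OF alphabet] by blast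

lemma finite_C: "finite (C k)"
  using cantor_set_subset[OF alphabet] finite_subset by blast

lemma sum_cantor_set_add:
  "(\<Sum>c\<in>C (k + l). f c) = (\<Sum>c\<in>C k. \<Sum>e\<in>C l. f (c + M ^ k * e))"
proof -
  have "inj_on (\<lambda>(c, e). c + M ^ k * e) (C k \<times> C l)"
    by (intro inj_onI, clarify) (rule add_mult_inject[OF cantor_less cantor_less])
  then show ?thesis
    by (simp add: cantor_set_add sum.reindex sum.cartesian_product case_prod_unfold)
qed

lemma sum_cantor_set_Suc: "(\<Sum>c\<in>C (Suc k). f c) = (\<Sum>c\<in>C k. \<Sum>a\<in>A. f (c + M ^ k * a))"
  using sum_cantor_set_add[of f k "Suc 0"] by (simp add: cantor_set_1)

lemma card_cantor_set: "card (C k) = card A ^ k"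
proof (induction k)
  case (Suc k)
  have "(\<Sum>c\<in>C (Suc k). 1) = card (C k) * card A"
    unfolding sum_cantor_set_Suc by simp
  with Suc show ?case by simp
qed (simp add: cantor_set_0)

section \<open>Submultiplicativity\<close>

text \<open>
  One step of the fast Fourier transform. With the frequency cut after \<open>k\<close> digits and the position
  after \<open>l\<close> digits, the phase of the product of the two high parts is trivial, so that the transform of
  length \<open>M ^ (k + l)\<close> becomes transforms of length \<open>M ^ k\<close> (in the high digits of the position),
  followed by a twist by unimodular factors and transforms of length \<open>M ^ l\<close>.
\<close>

lemma cantor_dft_sum_add:
  "cantor_dft_sum M A (k + l) v (q + M ^ k * p)
   = cantor_dft_sum M A l (\<lambda>b. phase (real q * real b / real (M ^ (k + l)))
       * cantor_dft_sum M A k (\<lambda>a. v (b + M ^ l * a)) q) p"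
proof -
  have "phase (real (q + M ^ k * p) * real (b + M ^ l * a) / real (M ^ (k + l)))
      = phase (real p * real b / real (M ^ l)) * (phase (real q * real b / real (M ^ (k + l)))
         * phase (real q * real a / real (M ^ k)))" for a b
  proof -
    have "real (q + M ^ k * p) * real (b + M ^ l * a) / real (M ^ (k + l))
        = real p * real b / real (M ^ l) + (real q * real b / real (M ^ (k + l))
          + real q * real a / real (M ^ k)) + real (p * a)"
      using M_pos by (simp add: field_simps power_add)
    then show ?thesis by (simp only: phase_add phase_of_nat mult_1_right)
  qed
  then show ?thesis
    unfolding cantor_dft_sum_def add.commute[of k l] sum_cantor_set_add[of _ l k]
    by (simp only: sum_distrib_left mult.assoc)
qed

text \<open>
  In the factorization \<open>cantor_dft_sum_add\<close> the twist preserves absolute values, so the two rounds of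
  shorter transforms may be estimated separately.
\<close>

lemma fup_norm_submultiplicative: "fup_norm M A (k + l) \<le> fup_norm M A k * fup_norm M A l"
proof (rule fup_norm_le[OF alphabet M_pos])
  show "0 \<le> fup_norm M A k * fup_norm M A l"
    using fup_norm_nonneg[OF alphabet M_pos] by simp
next
  fix v
  define U where "U = (\<lambda>q b. cantor_dft_sum M A k (\<lambda>a. v (b + M ^ l * a)) q)"
  define w where "w = (\<lambda>q b. phase (real q * real b / real (M ^ (k + l))) * U q b)"
  have cmod_w: "cmod (w q b) = cmod (U q b)" for q b
    by (simp add: w_def norm_mult)
  have "(\<Sum>j\<in>C (k + l). (cmod (cantor_dft_sum M A (k + l) v j))\<^sup>2)
      = (\<Sum>q\<in>C k. \<Sum>p\<in>C l. (cmod (cantor_dft_sum M A l (w q) p))\<^sup>2)"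
    by (simp only: sum_cantor_set_add cantor_dft_sum_add w_def U_def)
  also have "\<dots> \<le> (\<Sum>q\<in>C k. real (M ^ l) * (fup_norm M A l)\<^sup>2 * (\<Sum>b\<in>C l. (cmod (w q b))\<^sup>2))"
    by (intro sum_mono sum_cantor_dft_sum_le alphabet M_pos)
  also have "\<dots> = real (M ^ l) * (fup_norm M A l)\<^sup>2 * (\<Sum>b\<in>C l. \<Sum>q\<in>C k. (cmod (U q b))\<^sup>2)"
    by (simp only: cmod_w sum_distrib_left[symmetric] sum.swap[of _ "C k" "C l"])
  also have "\<dots> \<le> real (M ^ l) * (fup_norm M A l)\<^sup>2 *
      (\<Sum>b\<in>C l. real (M ^ k) * (fup_norm M A k)\<^sup>2 * (\<Sum>a\<in>C k. (cmod (v (b + M ^ l * a)))\<^sup>2))"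
    unfolding U_def
    by (intro mult_left_mono sum_mono sum_cantor_dft_sum_le alphabet M_pos) simp
  also have "\<dots> = real (M ^ (k + l)) * (fup_norm M A k * fup_norm M A l)\<^sup>2 *
      (\<Sum>c\<in>C (k + l). (cmod (v c))\<^sup>2)"
    unfolding add.commute[of k l] sum_cantor_set_add[of _ l k]
    by (simp add: sum_distrib_left[symmetric] power_add power_mult_distrib mult_ac)
  finally show "(\<Sum>j\<in>C (k + l). (cmod (cantor_dft_sum M A (k + l) v j))\<^sup>2)
      \<le> real (M ^ (k + l)) * (fup_norm M A k * fup_norm M A l)\<^sup>2 * (\<Sum>c\<in>C (k + l). (cmod (v c))\<^sup>2)" .
qed

section \<open>Modulated indicators as test vectors\<close>

definition normalized_G :: "real \<Rightarrow> real" where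
  "normalized_G x = cmod (\<Sum>a\<in>A. phase (real a * x)) / real (card A)"

text \<open>
  Apart from its normalization to \<open>weight k 0 = 1\<close>, the weight at an integer \<open>n\<close> is the absolute value
  at \<open>n\<close> of the Fourier transform of the indicator function of the Cantor set of order \<open>k\<close>; see
  \<open>cmod_sum_phase_cantor_set\<close>.
\<close>

definition weight :: "nat \<Rightarrow> real \<Rightarrow> real" where
  "weight k x = (\<Prod>s<k. normalized_G (x / real M ^ Suc s))"

lemma normalized_G_nonneg: "0 \<le> normalized_G x"
  by (simp add: normalized_G_def)

lemma weight_nonneg: "0 \<le> weight k x"
  by (simp add: weight_def prod_nonneg normalized_G_nonneg)

lemma normalized_G_0: "normalized_G 0 = 1"
  using card_gt_1 phase_of_nat[of 0] by (simp add: normalized_G_def)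

lemma normalized_G_add_int: "normalized_G (x + of_int n) = normalized_G x"
proof -
  have "phase (real a * (x + of_int n)) = phase (real a * x)" for a
  proof -
    have "real a * (x + of_int n) = real a * x + of_int (int a * n)"
      by (simp add: algebra_simps)
    then show ?thesis by (simp only: phase_add phase_of_int mult_1_right)
  qed
  then show ?thesis by (simp add: normalized_G_def)
qed

lemma weight_add: "weight (k + l) x = weight k x * (\<Prod>t<l. normalized_G (x / real M ^ (k + Suc t)))"
  by (simp add: weight_def prod_lessThan_add)

text \<open>
  Changing digits beyond the first \<open>k\<close> shifts every argument in the product by an integer, and
  \<^term>\<open>normalized_G\<close> has period one.
\<close>

lemma weight_add_multiple: "weight k (x + real M ^ k * of_int n) = weight k x"
  unfolding weight_def
proof (intro prod.cong refl)
  fix s assume "s \<in> {..<k}"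
  then have "real M ^ k = real M ^ Suc s * real M ^ (k - Suc s)"
    by (simp only: power_add[symmetric]) simp
  then have "(x + real M ^ k * of_int n) / real M ^ Suc s
      = x / real M ^ Suc s + of_int (int M ^ (k - Suc s) * n)"
    using M_pos by (simp add: field_simps)
  then show "normalized_G ((x + real M ^ k * of_int n) / real M ^ Suc s)
      = normalized_G (x / real M ^ Suc s)"
    by (simp only: normalized_G_add_int)
qed

lemma sum_phase_cantor_set:
  "(\<Sum>c\<in>C k. phase (real c * x)) = (\<Prod>i<k. \<Sum>a\<in>A. phase (real a * (x * real M ^ i)))"
proof (induction k)
  case 0
  show ?case using phase_of_nat[of 0] by (simp add: cantor_set_0)
next
  case (Suc k)
  have "phase (real (c + M ^ k * a) * x)
      = phase (real c * x) * phase (real a * (x * real M ^ k))" for a c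
    unfolding phase_add[symmetric] by (simp add: algebra_simps)
  then show ?case
    by (simp only: sum_cantor_set_Suc prod.lessThan_Suc Suc.IH[symmetric] sum_product)
qed

text \<open>
  The digits of an element of the Cantor set vary independently, so its exponential sum is the product
  over the digit positions of the sums over the alphabet. The position \<open>i\<close> contributes the factor with
  \<open>M ^ (k - i)\<close> in the denominator.
\<close>

lemma cmod_sum_phase_cantor_set:
  "cmod (\<Sum>c\<in>C k. phase (real c * (x / real M ^ k))) = real (card A) ^ k * weight k x"
proof -
  have "cmod (\<Sum>c\<in>C k. phase (real c * (x / real M ^ k)))
      = (\<Prod>i<k. real (card A) * normalized_G (x / real M ^ k * real M ^ i))"
    using card_gt_1 unfolding sum_phase_cantor_set prod_norm[symmetric] normalized_G_def by simp
  also have "\<dots> = (\<Prod>i<k. real (card A) * normalized_G (x / real M ^ Suc (k - Suc i)))"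
  proof (intro prod.cong refl)
    fix i assume "i \<in> {..<k}"
    then have "real M ^ k = real M ^ Suc (k - Suc i) * real M ^ i"
      by (simp flip: power_add power_Suc)
    then show "real (card A) * normalized_G (x / real M ^ k * real M ^ i)
        = real (card A) * normalized_G (x / real M ^ Suc (k - Suc i))"
      using M_pos by (simp add: field_simps)
  qed
  also have "\<dots> = (\<Prod>i<k. real (card A) * normalized_G (x / real M ^ Suc i))"
    by (rule prod.nat_diff_reindex)
  finally show ?thesis by (simp add: weight_def prod.distrib)
qed

text \<open>
  The operator is applied to the indicator function of the Cantor set modulated by the frequency \<open>z\<close>.
  Its image at \<open>j\<close> is the Fourier transform of the indicator function at \<open>j - z\<close>, and the square of
  its norm is the cardinality of the Cantor set.
\<close>

lemma sum_weight_le: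
  assumes "z \<in> C k"
  shows "(real (card A) / real M) ^ k * (\<Sum>j\<in>C k. (weight k (real j - real z))\<^sup>2) \<le> (fup_norm M A k)\<^sup>2"
proof -
  define v where "v = (\<lambda>l. phase (- (real z * real l / real (M ^ k))))"
  have "cantor_dft_sum M A k v j = (\<Sum>c\<in>C k. phase (real c * ((real j - real z) / real M ^ k)))" for j
    unfolding cantor_dft_sum_def v_def phase_add[symmetric]
    by (intro sum.cong refl arg_cong[of _ _ phase]) (simp add: diff_divide_distrib algebra_simps)
  then have "cmod (cantor_dft_sum M A k v j) = real (card A) ^ k * weight k (real j - real z)" for j
    by (simp only: cmod_sum_phase_cantor_set)
  then have "(real (card A) ^ k)\<^sup>2 * (\<Sum>j\<in>C k. (weight k (real j - real z))\<^sup>2)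
      \<le> real M ^ k * (fup_norm M A k)\<^sup>2 * real (card A) ^ k"
    using sum_cantor_dft_sum_le[OF alphabet M_pos, of k v]
    by (simp add: power_mult_distrib sum_distrib_left[symmetric] v_def card_cantor_set)
  then show ?thesis
    using M_pos card_gt_1 by (simp add: field_simps power_divide power2_eq_square)
qed

section \<open>Existence of the exponent\<close>

text \<open>
  The term \<open>j = z\<close> alone in \<open>sum_weight_le\<close> gives the bound that corresponds to the exponent
  \<open>(1 - \<delta>) / 2\<close>; the later sections improve it with the other terms. Here it shows that the norms are
  positive and decay at most exponentially, as Fekete's lemma requires.
\<close>

lemma fup_norm_lower_bound: "(real (card A) / real M) ^ k \<le> (fup_norm M A k)\<^sup>2"
proof -
  obtain b where "b \<in> A" using card_gt_1 by fastforce
  then have z: "(\<Sum>i<k. b * M ^ i) \<in> C k" (is "?z \<in> _")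
    by (auto simp: cantor_set_def)
  have "1 = (weight k (real ?z - real ?z))\<^sup>2"
    by (simp add: weight_def normalized_G_0)
  also have "\<dots> \<le> (\<Sum>j\<in>C k. (weight k (real j - real ?z))\<^sup>2)"
    using z by (intro member_le_sum) (auto simp: finite_C)
  finally have "(real (card A) / real M) ^ k * 1
      \<le> (real (card A) / real M) ^ k * (\<Sum>j\<in>C k. (weight k (real j - real ?z))\<^sup>2)"
    by (intro mult_left_mono) auto
  with sum_weight_le[OF z] show ?thesis by linarith
qed

lemma fup_norm_pos: "0 < fup_norm M A k"
proof -
  have "0 < (real (card A) / real M) ^ k" using card_gt_1 M_pos by simp
  with fup_norm_lower_bound[of k] have "fup_norm M A k \<noteq> 0" by auto
  then show ?thesis using fup_norm_nonneg[OF alphabet M_pos, of k] by linarith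
qed

lemma ln_fup_norm_ge:
  assumes "(real (card A) / real M) ^ k * \<rho> \<le> (fup_norm M A k)\<^sup>2" and "0 < \<rho>"
  shows "real k * (ln (real (card A) / real M) / 2) + ln \<rho> / 2 \<le> ln (fup_norm M A k)"
proof -
  have "ln ((real (card A) / real M) ^ k * \<rho>) \<le> ln ((fup_norm M A k)\<^sup>2)"
    using assms card_gt_1 M_pos by (intro ln_mono) auto
  moreover have "ln ((real (card A) / real M) ^ k * \<rho>) = real k * ln (real (card A) / real M) + ln \<rho>"
    using assms card_gt_1 M_pos by (subst ln_mult) (auto simp: ln_realpow)
  moreover have "ln ((fup_norm M A k)\<^sup>2) = 2 * ln (fup_norm M A k)"
    using fup_norm_pos by (simp add: ln_realpow)
  ultimately show ?thesis by linarith
qed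

text \<open>
  Convergence matters because \<^term>\<open>fup_exponent\<close> is defined with \<^term>\<open>lim\<close>: only then may the exponent
  be computed along a subsequence.
\<close>

lemma convergent_fup_exponent: "convergent (\<lambda>k. ln (fup_norm M A k) / (real k * ln (real M)))"
proof -
  have "convergent (\<lambda>k. ln (fup_norm M A k) / real k)"
  proof (rule subadditive_average_convergent)
    fix m n
    have "ln (fup_norm M A (m + n)) \<le> ln (fup_norm M A m * fup_norm M A n)"
      using fup_norm_submultiplicative fup_norm_pos by (intro ln_mono) auto
    then show "ln (fup_norm M A (m + n)) \<le> ln (fup_norm M A m) + ln (fup_norm M A n)"
      by (simp only: ln_mult_pos fup_norm_pos)
  next
    show "ln (real (card A) / real M) / 2 * real n \<le> ln (fup_norm M A n)" for n
      using ln_fup_norm_ge[of n 1] fup_norm_lower_bound[of n] by (simp add: mult.commute)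
  qed
  then obtain L where "(\<lambda>k. ln (fup_norm M A k) / real k) \<longlonglongrightarrow> L"
    by (auto simp: convergent_def)
  then have "(\<lambda>k. ln (fup_norm M A k) / real k / ln (real M)) \<longlonglongrightarrow> L / ln (real M)"
    using M_ge_3 by (intro tendsto_divide tendsto_const) auto
  then show ?thesis by (auto simp: convergent_def divide_divide_eq_left)
qed

end

section \<open>Lower bounds for the normalized exponential sum\<close>

lemma one_minus_sum_le_prod:
  fixes v :: "nat \<Rightarrow> real"
  assumes "\<And>t. 0 \<le> v t" and "\<And>t. v t \<le> 1"
  shows "1 - (\<Sum>t<n. v t) \<le> (\<Prod>t<n. 1 - v t)"
proof (induction n)
  case (Suc n)
  have "(\<Prod>t<n. 1 - v t) \<le> 1"
    using assms by (intro prod_le_1) auto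
  then have "(\<Prod>t<n. 1 - v t) * v n \<le> 1 * v n"
    using assms by (intro mult_right_mono)
  with Suc show ?case by (simp add: right_diff_distrib)
qed auto

lemma cos_ge_quadratic: "1 - x\<^sup>2 / 2 \<le> cos (x::real)"
proof -
  have "(sin (x / 2))\<^sup>2 \<le> (x / 2)\<^sup>2"
    using abs_sin_x_le_abs_x[of "x / 2"] by (simp only: abs_le_square_iff)
  then show ?thesis
    using cos_double_sin[of "x / 2"] by (simp add: power_divide)
qed

lemma pi_squared_less_16: "pi\<^sup>2 < 16"
  using power_strict_mono[of pi 4 2] pi_less_4 by simp

context cantor_alphabet
begin

text \<open>
  All the terms of the sum have almost the same phase when \<open>x\<close> is small compared with \<open>1 / M\<close>.
  Dividing by the phase of the midpoint \<open>M / 2\<close> of the digit range halves the largest deviation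
  before real parts are taken.
\<close>

lemma normalized_G_ge: "1 - pi\<^sup>2 / 2 * (real M * x)\<^sup>2 \<le> normalized_G x"
proof -
  have cos_ge: "1 - pi\<^sup>2 / 2 * (real M * x)\<^sup>2
      \<le> Re (phase (real a * x - real M / 2 * x))" if "a \<in> A" for a
  proof -
    have "a < M" using that alphabet by auto
    then have "\<bar>2 * real a - real M\<bar> \<le> real M" by linarith
    then have "(2 * real a - real M)\<^sup>2 \<le> (real M)\<^sup>2" by (simp add: abs_le_square_iff[symmetric])
    then have "(2 * real a - real M)\<^sup>2 * (pi * x)\<^sup>2 \<le> (real M)\<^sup>2 * (pi * x)\<^sup>2"
      by (rule mult_right_mono) simp
    moreover have "2 * pi * (real a * x - real M / 2 * x) = (2 * real a - real M) * (pi * x)"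
      by (simp add: algebra_simps)
    ultimately have "(2 * pi * (real a * x - real M / 2 * x))\<^sup>2 \<le> pi\<^sup>2 * (real M * x)\<^sup>2"
      by (simp only: power_mult_distrib mult_ac)
    then show ?thesis
      using cos_ge_quadratic[of "2 * pi * (real a * x - real M / 2 * x)"]
      by (simp add: phase_def)
  qed
  have "real (card A) * (1 - pi\<^sup>2 / 2 * (real M * x)\<^sup>2)
      \<le> (\<Sum>a\<in>A. Re (phase (real a * x - real M / 2 * x)))"
    using sum_mono[OF cos_ge, of A "\<lambda>a. a"] by simp
  also have "\<dots> = Re (phase (- (real M / 2 * x)) * (\<Sum>a\<in>A. phase (real a * x)))"
    by (simp only: sum_distrib_left phase_add[symmetric] Re_sum) (simp add: add.commute)
  also have "\<dots> \<le> cmod (phase (- (real M / 2 * x)) * (\<Sum>a\<in>A. phase (real a * x)))"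
    by (rule complex_Re_le_cmod)
  also have "\<dots> = real (card A) * normalized_G x"
    using card_gt_1 by (simp add: norm_mult normalized_G_def)
  finally show ?thesis using card_gt_1 by simp
qed

text \<open>
  The quadratic bound \<open>normalized_G_ge\<close> shows that the factors approach one geometrically, so that
  the product is bounded below uniformly in its length. The numerical constant is
  \<open>(\<pi>\<^sup>2 / 2) * (1 / 9 + 1 / 81 + \<dots>) = \<pi>\<^sup>2 / 16 < 1\<close>, where \<open>1 / 9\<close> bounds \<open>1 / M\<^sup>2\<close>; it is
  essential that the bound is still positive for \<open>B = 1 / M\<close>.
\<close>

lemma prod_normalized_G_ge:
  assumes "0 \<le> B" and "real M * B \<le> 1" and "\<And>t. t < T \<Longrightarrow> \<bar>x t\<bar> \<le> B / real M ^ Suc t"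
  shows "1 - pi\<^sup>2 / 16 * (real M * B)\<^sup>2 \<le> (\<Prod>t<T. normalized_G (x t))"
proof -
  \<comment> \<open>the factors \<open>1 - v t\<close> are nonnegative because \<open>c / 9 < 1\<close>, which follows from \<open>\<pi> < 4\<close>\<close>
  define c where "c = pi\<^sup>2 / 2 * (real M * B)\<^sup>2"
  define v where "v = (\<lambda>t. c * (1 / 9) ^ Suc t)"
  have "(real M * B)\<^sup>2 \<le> 1"
    using assms by (intro power_le_one) auto
  then have "pi\<^sup>2 * (real M * B)\<^sup>2 \<le> 16 * 1"
    using pi_squared_less_16 by (intro mult_mono) auto
  then have c: "0 \<le> c" "c \<le> 8" by (simp_all add: c_def)
  have v: "0 \<le> v t" "v t \<le> 1" for t
  proof -
    show "0 \<le> v t" using c by (simp add: v_def)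
    have "(1 / 9 :: real) ^ t \<le> 1" by (simp add: power_le_one)
    then have "c * (1 / 9) ^ t \<le> 8 * 1" using c by (intro mult_mono) auto
    then show "v t \<le> 1" by (simp add: v_def)
  qed
  have "(\<Sum>t<T. (1 / 9 :: real) ^ Suc t) \<le> 1 / 8"
  proof -
    have "(\<Sum>t<T. (1 / 9 :: real) ^ Suc t) = (1 - (1 / 9) ^ T) / 8"
      by (induction T) (simp_all add: diff_divide_distrib)
    then show ?thesis by simp
  qed
  then have "(\<Sum>t<T. v t) \<le> c * (1 / 8)"
    unfolding v_def sum_distrib_left[symmetric] using c by (intro mult_left_mono)
  then have "1 - pi\<^sup>2 / 16 * (real M * B)\<^sup>2 \<le> 1 - (\<Sum>t<T. v t)"
    by (simp add: c_def)
  also have "\<dots> \<le> (\<Prod>t<T. 1 - v t)"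
    using v by (rule one_minus_sum_le_prod)
  also have "\<dots> \<le> (\<Prod>t<T. normalized_G (x t))"
  proof (rule prod_mono)
    fix t assume "t \<in> {..<T}"
    then have "\<bar>real M * x t\<bar> \<le> real M * (B / real M ^ Suc t)"
      unfolding abs_mult using assms(3) by (intro mult_mono) auto
    then have "(real M * x t)\<^sup>2 \<le> (real M * (B / real M ^ Suc t))\<^sup>2"
      by (metis abs_ge_zero power2_abs power_mono)
    also have "\<dots> = (real M * B)\<^sup>2 * (1 / (real M)\<^sup>2) ^ Suc t"
      by (simp add: power_mult_distrib power_divide power_one_over power_mult[symmetric] mult.commute)
    also have "\<dots> \<le> (real M * B)\<^sup>2 * (1 / 9) ^ Suc t"
    proof (intro mult_left_mono power_mono)
      have "3\<^sup>2 \<le> (real M)\<^sup>2" using M_ge_3 by (intro power_mono) auto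
      then show "1 / (real M)\<^sup>2 \<le> 1 / 9" by (intro frac_le) auto
    qed auto
    finally have "pi\<^sup>2 / 2 * (real M * x t)\<^sup>2 \<le> pi\<^sup>2 / 2 * ((real M * B)\<^sup>2 * (1 / 9) ^ Suc t)"
      by (intro mult_left_mono) auto
    moreover have "v t = pi\<^sup>2 / 2 * ((real M * B)\<^sup>2 * (1 / 9) ^ Suc t)"
      by (simp only: v_def c_def mult.assoc)
    ultimately show "0 \<le> 1 - v t \<and> 1 - v t \<le> normalized_G (x t)"
      using v[of t] normalized_G_ge[of "x t"] by linarith
  qed
  finally show ?thesis .
qed

text \<open>
  The factors of one further block of \<open>L\<close> digits, when the difference \<open>n\<close> of two digit expansions is
  small compared with \<open>M ^ K\<close> because it comes from much lower digits. The bound tends to one as \<open>B\<close>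
  tends to zero.
\<close>

lemma prod_normalized_G_unchanged_block:
  assumes "0 \<le> B" and "real M * B \<le> 1" and "\<bar>n\<bar> \<le> real M ^ K * B"
  shows "1 - pi\<^sup>2 / 16 * (real M * B)\<^sup>2 \<le> (\<Prod>t<L. normalized_G (n / real M ^ (K + Suc t)))"
proof (rule prod_normalized_G_ge[OF assms(1,2)])
  fix t
  have "\<bar>n / real M ^ (K + Suc t)\<bar> \<le> real M ^ K * B / real M ^ (K + Suc t)"
    using assms(3) by (simp add: divide_right_mono del: power_Suc add_Suc_right)
  also have "\<dots> = B / real M ^ Suc t"
    using M_pos by (simp add: power_add)
  finally show "\<bar>n / real M ^ (K + Suc t)\<bar> \<le> B / real M ^ Suc t" .
qed

text \<open>
  The factors of one further block of \<open>L\<close> digits, when the lowest digit of the block is changed by \<open>d\<close>.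
  The arguments of the first two factors are close to \<open>d / M\<close> and \<open>d / M\<^sup>2\<close>; from the third factor on,
  the argument is small enough for \<open>prod_normalized_G_ge\<close> with \<open>B = 1 / M\<close>. The bound does not depend
  on the length of the block.
\<close>

lemma prod_normalized_G_changed_block:
  assumes "0 \<le> B" and "real M * B \<le> 1" and n: "\<bar>n\<bar> \<le> real M ^ K * B"
    and d: "\<bar>d\<bar> \<le> real M - 1" and L: "2 \<le> L" and "0 \<le> c"
    and c1: "\<And>y. \<bar>y - d / real M\<bar> \<le> B \<Longrightarrow> c \<le> normalized_G y"
    and c2: "\<And>y. \<bar>y - d / (real M)\<^sup>2\<bar> \<le> B \<Longrightarrow> c \<le> normalized_G y"
  shows "c\<^sup>2 * (1 - pi\<^sup>2 / 16) \<le> (\<Prod>t<L. normalized_G ((n + real M ^ K * d) / real M ^ (K + Suc t)))"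
proof -
  define x where "x = (\<lambda>t. (n + real M ^ K * d) / real M ^ (K + Suc t))"
  have near: "\<bar>x t - d / real M ^ Suc t\<bar> \<le> B" for t
  proof -
    have "x t - d / real M ^ Suc t = n / real M ^ K / real M ^ Suc t"
      using M_pos by (simp add: x_def power_add field_simps)
    moreover have "\<bar>n / real M ^ K\<bar> \<le> B"
      using n M_pos by (simp add: field_simps)
    moreover have "1 \<le> real M ^ Suc t"
      using M_pos by (intro one_le_power) simp
    then have "\<bar>n / real M ^ K / real M ^ Suc t\<bar> \<le> \<bar>n / real M ^ K\<bar> / 1"
      unfolding abs_divide[of _ "real M ^ Suc t"] by (intro divide_left_mono) auto
    ultimately show ?thesis by simp
  qed
  have "B \<le> real M * B"
    using assms(1) M_pos by (simp add: mult_le_cancel_right1)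
  then have "real M ^ K * B \<le> real M ^ K * 1"
    using assms(2) by (intro mult_left_mono) auto
  moreover have "\<bar>real M ^ K * d\<bar> \<le> real M ^ K * (real M - 1)"
    unfolding abs_mult using d by (intro mult_mono) auto
  \<comment> \<open>the difference keeps absolute value at most \<open>M ^ (K + 1)\<close>, as \<open>n\<close> is at most \<open>M ^ K\<close>\<close>
  ultimately have nd: "\<bar>n + real M ^ K * d\<bar> \<le> real M ^ K * real M"
    using n by (simp add: right_diff_distrib)
  have "1 - pi\<^sup>2 / 16 * (real M * (1 / real M))\<^sup>2 \<le> (\<Prod>t<L - 2. normalized_G (x (2 + t)))"
  proof (rule prod_normalized_G_ge)
    fix t
    have "\<bar>x (2 + t)\<bar> \<le> real M ^ K * real M / real M ^ (K + Suc (2 + t))"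
      unfolding x_def abs_divide using nd M_pos by (intro divide_mono) auto
    also have "\<dots> = 1 / real M / real M ^ Suc t"
      using M_pos by (simp add: power_add field_simps)
    finally show "\<bar>x (2 + t)\<bar> \<le> 1 / real M / real M ^ Suc t" .
  qed (use M_pos in auto)
  then have tail: "1 - pi\<^sup>2 / 16 \<le> (\<Prod>t<L - 2. normalized_G (x (2 + t)))"
    using M_pos by simp
  have "c \<le> normalized_G (x 0)" "c \<le> normalized_G (x 1)"
    using c1[of "x 0"] c2[of "x 1"] near[of 0] near[of 1] by (simp_all add: power2_eq_square)
  then have "c * c \<le> normalized_G (x 0) * normalized_G (x 1)"
    using assms by (intro mult_mono) (auto simp: normalized_G_nonneg)
  moreover have "0 \<le> 1 - pi\<^sup>2 / 16"
    using pi_squared_less_16 by simp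
  ultimately have "c * c * (1 - pi\<^sup>2 / 16)
      \<le> normalized_G (x 0) * normalized_G (x 1) * (\<Prod>t<L - 2. normalized_G (x (2 + t)))"
    using tail by (intro mult_mono[of "c * c"]) (simp_all add: normalized_G_nonneg)
  also have "\<dots> = (\<Prod>t<2 + (L - 2). normalized_G (x t))"
    by (simp only: prod_lessThan_add) (simp add: numeral_2_eq_2)
  also have "2 + (L - 2) = L" using L by simp
  finally show ?thesis by (simp only: x_def power2_eq_square)
qed

lemma eventually_normalized_G_ge:
  assumes "c < normalized_G x"
  shows "\<forall>\<^sub>F l in sequentially. \<forall>y. \<bar>y - x\<bar> \<le> 1 / real M ^ l \<longrightarrow> c \<le> normalized_G y"
proof -
  have "isCont normalized_G x"
    unfolding normalized_G_def phase_def cis_conv_exp by (intro continuous_intros) (use card_gt_1 in auto)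
  then have "\<forall>\<^sub>F y in nhds x. c < normalized_G y"
    using assms by (intro order_tendstoD(1)) (simp add: isCont_def tendsto_at_iff_tendsto_nhds)
  then obtain e where e: "0 < e" "\<And>y. dist y x < e \<Longrightarrow> c < normalized_G y"
    by (auto simp: eventually_nhds_metric)
  have "(\<lambda>l. 1 / real M ^ l) \<longlonglongrightarrow> 0"
    using M_ge_3 LIMSEQ_inverse_realpow_zero[of "real M"] by (simp add: inverse_eq_divide)
  then have "\<forall>\<^sub>F l in sequentially. 1 / real M ^ l < e"
    using e by (intro order_tendstoD(2))
  then show ?thesis
  proof eventually_elim
    case (elim l)
    then have "dist y x < e" if "\<bar>y - x\<bar> \<le> 1 / real M ^ l" for y
      using that by (simp add: dist_real_def)
    with e(2) show ?case by (simp add: less_imp_le)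
  qed
qed

section \<open>Exponential gain\<close>

text \<open>
  The exponential gain. All the digits of \<open>z\<close> are \<open>b\<close>, and they are grouped into \<open>m\<close> blocks of length
  \<open>l + 1\<close>. Among the \<open>j\<close> are the numbers obtained from \<open>z\<close> by replacing the lowest digit of some of the
  blocks by \<open>b'\<close>. Every further block offers two choices: to leave it as it is, which multiplies the
  weight by at least a number close to one, or to change it, which multiplies the weight by at least a
  number independent of \<open>l\<close>. In the sum of the squared weights the two choices add up. The restriction
  on \<open>\<bar>j - z\<bar>\<close> carries through the induction that the changes made so far lie at least \<open>l\<close> digits below
  the end of the expansion, so that they hardly disturb the next block.
\<close>

lemma sum_weight_growth:
  assumes b: "b \<in> A" "b' \<in> A" "b \<noteq> b'" and l: "1 \<le> l"
  defines "B \<equiv> 1 / real M ^ l" and "d \<equiv> real b' - real b"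
  assumes c: "0 \<le> c"
    and c1: "\<And>y. \<bar>y - d / real M\<bar> \<le> B \<Longrightarrow> c \<le> normalized_G y"
    and c2: "\<And>y. \<bar>y - d / (real M)\<^sup>2\<bar> \<le> B \<Longrightarrow> c \<le> normalized_G y"
  shows "\<exists>z\<in>C (Suc l * m). ((1 - pi\<^sup>2 / 16 * (real M * B)\<^sup>2)\<^sup>2 + (c\<^sup>2 * (1 - pi\<^sup>2 / 16))\<^sup>2) ^ m
    \<le> (\<Sum>j\<in>{j\<in>C (Suc l * m). \<bar>real j - real z\<bar> \<le> real M ^ (Suc l * m) * B}.
          (weight (Suc l * m) (real j - real z))\<^sup>2)"
    (is "\<exists>z\<in>_. (?stay\<^sup>2 + ?move\<^sup>2) ^ m \<le> _")
proof (induction m)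
  case 0
  have "{j \<in> C 0. \<bar>real j - real 0\<bar> \<le> B} = {0}"
    by (auto simp: cantor_set_0 B_def)
  then show ?case by (simp add: cantor_set_0 weight_def)
next
  case (Suc m)
  define K where "K = Suc l * m"
  define Y where "Y = (\<lambda>k z. {j\<in>C k. \<bar>real j - real z\<bar> \<le> real M ^ k * B})"
  have KL: "Suc l * Suc m = K + Suc l" by (simp add: K_def)
  from Suc obtain z where z: "z \<in> C K"
    and IH: "(?stay\<^sup>2 + ?move\<^sup>2) ^ m \<le> (\<Sum>j\<in>Y K z. (weight K (real j - real z))\<^sup>2)"
    unfolding K_def Y_def by blast
  have B: "0 \<le> B" "real M * B \<le> 1" "real M ^ Suc l * B = real M"
  proof -
    have "real M ^ 1 \<le> real M ^ l" using l M_pos by (intro power_increasing) auto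
    then show "real M * B \<le> 1" using M_pos by (simp add: B_def field_simps)
  qed (use M_pos in \<open>simp_all add: B_def\<close>)
  have d: "\<bar>d\<bar> \<le> real M - 1"
    using b alphabet by (auto simp: d_def subset_iff abs_if)
  have stay: "0 \<le> ?stay"
  proof -
    have "pi\<^sup>2 * (real M * B)\<^sup>2 \<le> 16 * 1"
      using B pi_squared_less_16 by (intro mult_mono power_le_one) auto
    then show ?thesis by simp
  qed
  have move: "0 \<le> ?move"
    using pi_squared_less_16 by simp
  \<comment> \<open>the block consists of a lowest digit \<open>a\<close>, either \<open>b\<close> or \<open>b'\<close>, and \<open>l\<close> digits \<open>b\<close> above it\<close>
  define e where "e = (\<Sum>i<l. b * M ^ i)"
  define f where "f = (\<lambda>a y. y + M ^ K * (a + M * e))"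
  have "e \<in> C l" using b by (auto simp: e_def cantor_set_def)
  then have "a + M * e \<in> C (Suc l)" if "a \<in> A" for a
    using that cantor_set_add[of M A "Suc 0" l] by (auto simp: cantor_set_1 image_iff)
  then have f_in: "f a y \<in> C (K + Suc l)" if "a \<in> A" "y \<in> C K" for a y
    using that cantor_set_add[of M A K "Suc l"] unfolding f_def by (auto simp: image_iff)
  have f_eq: "y = y' \<and> a = a'" if "f a y = f a' y'" "y \<in> C K" "y' \<in> C K" for a a' y y'
    using add_mult_inject[of y "M ^ K" y' "a + M * e" "a' + M * e"] that cantor_less
    by (auto simp: f_def)
  define z' where "z' = f b z"
  have z': "z' \<in> C (K + Suc l)" using f_in b z by (simp add: z'_def)
  have diff: "real (f b y) - real z' = real y - real z"
    "real (f b' y) - real z' = (real y - real z) + real M ^ K * d" for y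
    by (simp_all add: z'_def f_def d_def algebra_simps)
  have M_ge: "1 \<le> real M" using M_pos by simp
  have sub: "f b ` Y K z \<union> f b' ` Y K z \<subseteq> Y (K + Suc l) z'"
  proof
    fix j assume "j \<in> f b ` Y K z \<union> f b' ` Y K z"
    then obtain y where y: "y \<in> Y K z" "j = f b y \<or> j = f b' y" by auto
    have j: "j \<in> C (K + Suc l)" using y f_in b by (auto simp: Y_def)
    have n: "\<bar>real y - real z\<bar> \<le> real M ^ K * B" using y by (simp add: Y_def)
    have "B \<le> real M * B" using B M_ge by (simp add: mult_le_cancel_right1)
    then have "real M ^ K * B \<le> real M ^ K * 1"
      using B by (intro mult_left_mono) auto
    moreover have "\<bar>real M ^ K * d\<bar> \<le> real M ^ K * (real M - 1)"
      unfolding abs_mult using d by (intro mult_mono) auto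
    moreover have "0 \<le> real M ^ K * (real M - 1)" using M_ge by simp
    ultimately have "\<bar>real j - real z'\<bar> \<le> real M ^ K * real M"
      using y(2) n diff[of y] by (auto simp: right_diff_distrib)
    also have "\<dots> = real M ^ (K + Suc l) * B"
      using B(3) by (simp add: power_add)
    finally show "j \<in> Y (K + Suc l) z'" using j by (simp add: Y_def)
  qed
  have fin: "finite (Y k w)" for k w by (simp add: Y_def finite_C)
  let ?W = "\<lambda>j. (weight (K + Suc l) (real j - real z'))\<^sup>2"
  have "(?stay\<^sup>2 + ?move\<^sup>2) ^ Suc m \<le> (\<Sum>y\<in>Y K z. (weight K (real y - real z))\<^sup>2) * (?stay\<^sup>2 + ?move\<^sup>2)"
    unfolding power_Suc2 using IH by (intro mult_right_mono) auto
  also have "\<dots> \<le> (\<Sum>y\<in>Y K z. ?W (f b y) + ?W (f b' y))"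
    unfolding sum_distrib_right
  proof (rule sum_mono)
    fix y assume y: "y \<in> Y K z"
    then have n: "\<bar>real y - real z\<bar> \<le> real M ^ K * B" by (simp add: Y_def)
    have "weight K (real y - real z) * ?stay \<le> weight (K + Suc l) (real (f b y) - real z')"
      unfolding diff weight_add
      by (intro mult_left_mono prod_normalized_G_unchanged_block B n weight_nonneg)
    then have 1: "(weight K (real y - real z) * ?stay)\<^sup>2 \<le> ?W (f b y)"
      using stay by (intro power_mono) (auto simp: weight_nonneg)
    have "weight K (real y - real z + real M ^ K * d) = weight K (real y - real z)"
      using weight_add_multiple[of K "real y - real z" "int b' - int b"] by (simp add: d_def)
    moreover have "?move
        \<le> (\<Prod>t<Suc l. normalized_G ((real y - real z + real M ^ K * d) / real M ^ (K + Suc t)))"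
      using l by (intro prod_normalized_G_changed_block[OF B(1,2) n d _ c c1 c2]) auto
    ultimately have "weight K (real y - real z) * ?move \<le> weight (K + Suc l) (real (f b' y) - real z')"
      unfolding diff weight_add by (simp only: mult_left_mono weight_nonneg)
    then have 2: "(weight K (real y - real z) * ?move)\<^sup>2 \<le> ?W (f b' y)"
      using move by (intro power_mono) (auto simp: weight_nonneg)
    show "(weight K (real y - real z))\<^sup>2 * (?stay\<^sup>2 + ?move\<^sup>2) \<le> ?W (f b y) + ?W (f b' y)"
      using add_mono[OF 1 2] by (simp only: power_mult_distrib distrib_left)
  qed
  also have "\<dots> = (\<Sum>j\<in>f b ` Y K z \<union> f b' ` Y K z. ?W j)"
  proof -
    have inj: "inj_on (f a) (Y K z)" for a
    proof (rule inj_onI)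
      show "y = y'" if "y \<in> Y K z" "y' \<in> Y K z" "f a y = f a y'" for y y'
        using f_eq[of a y a y'] that by (simp add: Y_def)
    qed
    have "f b y \<noteq> f b' y'" if "y \<in> Y K z" "y' \<in> Y K z" for y y'
      using f_eq[of b y b' y'] that b by (auto simp: Y_def)
    then have "f b ` Y K z \<inter> f b' ` Y K z = {}"
      by blast
    then show ?thesis
      by (simp add: sum.union_disjoint fin sum.reindex inj sum.distrib)
  qed
  also have "\<dots> \<le> (\<Sum>j\<in>Y (K + Suc l) z'. ?W j)"
    by (intro sum_mono2 fin sub) simp
  finally show ?case
    using z' unfolding KL Y_def by (intro bexI[of _ z']) auto
qed

lemma G_eq: "G M A x = 1 / complex_of_real (sqrt (real M)) * (\<Sum>a\<in>A. phase (real a * x))"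
  unfolding G_def exp_eq_phase ..

text \<open>
  As the block length grows, the factor of an unchanged block tends to one while that of a changed block
  stays fixed, so the sum of their squares eventually exceeds one. By continuity, the hypothesis on the
  two values of \<^term>\<open>G\<close> gives the lower bound \<open>c\<close> in neighbourhoods of both points.
\<close>

lemma fup_norm_exponential_gain:
  assumes b: "b \<in> A" "b' \<in> A" "b \<noteq> b'"
    and nonzero: "G M A ((real b' - real b) / real M) \<noteq> 0"
      "G M A ((real b' - real b) / (real M)\<^sup>2) \<noteq> 0"
  shows "\<exists>L>0. \<exists>\<rho>>1. \<forall>m. (real (card A) / real M) ^ (L * m) * \<rho> ^ m \<le> (fup_norm M A (L * m))\<^sup>2"
proof -
  define d where "d = real b' - real b"
  define c where "c = min (normalized_G (d / real M)) (normalized_G (d / (real M)\<^sup>2)) / 2"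
  have "0 < normalized_G (d / real M)" "0 < normalized_G (d / (real M)\<^sup>2)"
    using nonzero card_gt_1 by (auto simp: G_eq normalized_G_def d_def)
  then have c: "0 < c" "c < normalized_G (d / real M)" "c < normalized_G (d / (real M)\<^sup>2)"
    by (auto simp: c_def)
  define move where "move = c\<^sup>2 * (1 - pi\<^sup>2 / 16)"
  define stay where "stay = (\<lambda>l. 1 - pi\<^sup>2 / 16 * (real M * (1 / real M ^ l))\<^sup>2)"
  have "0 < move" using c pi_squared_less_16 by (simp add: move_def)
  have "(\<lambda>l. 1 / real M ^ l) \<longlonglongrightarrow> 0"
    using M_ge_3 LIMSEQ_inverse_realpow_zero[of "real M"] by (simp add: inverse_eq_divide)
  then have "(\<lambda>l. (stay l)\<^sup>2 + move\<^sup>2) \<longlonglongrightarrow> (1 - pi\<^sup>2 / 16 * (real M * 0)\<^sup>2)\<^sup>2 + move\<^sup>2"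
    unfolding stay_def by (intro tendsto_intros)
  then have "\<forall>\<^sub>F l in sequentially. 1 < (stay l)\<^sup>2 + move\<^sup>2"
    using \<open>0 < move\<close> by (intro order_tendstoD(1)) auto
  then have "\<forall>\<^sub>F l in sequentially. 1 \<le> l \<and> 1 < (stay l)\<^sup>2 + move\<^sup>2 \<and>
      (\<forall>y. \<bar>y - d / real M\<bar> \<le> 1 / real M ^ l \<longrightarrow> c \<le> normalized_G y) \<and>
      (\<forall>y. \<bar>y - d / (real M)\<^sup>2\<bar> \<le> 1 / real M ^ l \<longrightarrow> c \<le> normalized_G y)"
    using c by (intro eventually_conj eventually_normalized_G_ge eventually_ge_at_top)
  then obtain l where l: "1 \<le> l" "1 < (stay l)\<^sup>2 + move\<^sup>2"
    "\<And>y. \<bar>y - d / real M\<bar> \<le> 1 / real M ^ l \<Longrightarrow> c \<le> normalized_G y"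
    "\<And>y. \<bar>y - d / (real M)\<^sup>2\<bar> \<le> 1 / real M ^ l \<Longrightarrow> c \<le> normalized_G y"
    using eventually_happens'[OF sequentially_bot] by blast
  have gain: "(real (card A) / real M) ^ (Suc l * m) * ((stay l)\<^sup>2 + move\<^sup>2) ^ m
      \<le> (fup_norm M A (Suc l * m))\<^sup>2" for m
  proof -
    obtain z where z: "z \<in> C (Suc l * m)" and sum: "((stay l)\<^sup>2 + move\<^sup>2) ^ m
      \<le> (\<Sum>j\<in>{j\<in>C (Suc l * m). \<bar>real j - real z\<bar> \<le> real M ^ (Suc l * m) * (1 / real M ^ l)}.
          (weight (Suc l * m) (real j - real z))\<^sup>2)"
      using sum_weight_growth[OF b l(1) less_imp_le[OF c(1)] l(3,4)[unfolded d_def], of m]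
      unfolding stay_def move_def by blast
    note sum
    also have "\<dots> \<le> (\<Sum>j\<in>C (Suc l * m). (weight (Suc l * m) (real j - real z))\<^sup>2)"
      by (intro sum_mono2 finite_C) auto
    finally have "(real (card A) / real M) ^ (Suc l * m) * ((stay l)\<^sup>2 + move\<^sup>2) ^ m
        \<le> (real (card A) / real M) ^ (Suc l * m) * (\<Sum>j\<in>C (Suc l * m). (weight (Suc l * m) (real j - real z))\<^sup>2)"
      by (intro mult_left_mono) auto
    also have "\<dots> \<le> (fup_norm M A (Suc l * m))\<^sup>2"
      using z by (rule sum_weight_le)
    finally show ?thesis .
  qed
  show ?thesis
  proof (intro exI conjI allI)
    show "0 < Suc l" by simp
    show "1 < (stay l)\<^sup>2 + move\<^sup>2" by (fact l(2))
  qed (rule gain)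
qed

end

theorem proposition3p16:
  fixes M :: nat and A :: "nat set" and \<delta> :: real
  assumes "A \<subseteq> {0..<M}"
    and "1 < card A" and "card A < M"
    and "\<delta> = ln (real (card A)) / ln (real M)"
    and "\<exists>b\<in>A. \<exists>b'\<in>A. b \<noteq> b' \<and>
           G M A ((real b' - real b) / real M) * G M A ((real b' - real b) / (real M)\<^sup>2) \<noteq> 0"
  shows "fup_exponent M A < (1 - \<delta>) / 2"
proof -
  interpret cantor_alphabet M A
    using assms(1-3) by unfold_locales
  obtain b b' where "b \<in> A" "b' \<in> A" "b \<noteq> b'"
    "G M A ((real b' - real b) / real M) \<noteq> 0" "G M A ((real b' - real b) / (real M)\<^sup>2) \<noteq> 0"
    using assms(5) by auto
  then obtain L \<rho> where L: "0 < L" and \<rho>: "1 < \<rho>"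
    and gain: "\<And>m. (real (card A) / real M) ^ (L * m) * \<rho> ^ m \<le> (fup_norm M A (L * m))\<^sup>2"
    using fup_norm_exponential_gain by blast
  have lnM: "0 < ln (real M)" using M_ge_3 by simp
  define f where "f = (\<lambda>k. ln (fup_norm M A k) / (real k * ln (real M)))"
  define g where "g = ln \<rho> / (2 * real L * ln (real M))"
  have "f \<longlonglongrightarrow> lim f"
    using convergent_fup_exponent by (simp add: f_def convergent_LIMSEQ_iff)
  then have "(f \<circ> (\<lambda>m. L * m)) \<longlonglongrightarrow> lim f"
    by (rule LIMSEQ_subseq_LIMSEQ) (use L in \<open>simp add: strict_mono_def\<close>)
  moreover have "(\<delta> - 1) / 2 + g \<le> (f \<circ> (\<lambda>m. L * m)) m" if "1 \<le> m" for m
  proof -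
    have "real (L * m) * (ln (real (card A) / real M) / 2) + real m * ln \<rho> / 2
        \<le> ln (fup_norm M A (L * m))"
      using ln_fup_norm_ge[OF gain[of m]] \<rho> by (simp add: ln_realpow)
    then have "(real (L * m) * (ln (real (card A) / real M) / 2) + real m * ln \<rho> / 2) / (real (L * m) * ln (real M))
        \<le> f (L * m)"
      unfolding f_def using lnM by (intro divide_right_mono) auto
    moreover have "(real (L * m) * (ln (real (card A) / real M) / 2) + real m * ln \<rho> / 2) / (real (L * m) * ln (real M))
        = (\<delta> - 1) / 2 + g"
    proof -
      have eq: "ln (real (card A) / real M) = (\<delta> - 1) * ln (real M)"
        using assms(4) lnM card_gt_1 M_pos by (simp add: ln_div left_diff_distrib)
      show ?thesis
        unfolding eq g_def using L lnM that by (simp add: field_simps)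
    qed
    ultimately show ?thesis by simp
  qed
  ultimately have "(\<delta> - 1) / 2 + g \<le> lim f"
    by (intro LIMSEQ_le_const) blast+
  moreover have "0 < g" using \<rho> L lnM by (simp add: g_def)
  moreover have "fup_exponent M A = - lim f"
    by (simp only: fup_exponent_def f_def)
  ultimately show ?thesis by (simp add: field_simps)
qed

end
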